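(* Let $0<|q|<1$. With $S(2,4;q,N)$ the polynomial in $q$ defined in the context, the following limits hold (with $M$ running over the non-negative integers): $$\lim_{M\to\infty}S(2,4;q^{-1},3M+1)\,q^{(M+1)(3M+1)}=\sum_{a,b\ge 0}\frac{q^{a^2-3ab+3b^2+2b+1}}{(q^3;q^3)_b}\begin{bmatrix}3b-a\\ a\end{bmatrix}_q,$$ $$\lim_{M\to\infty}S(2,4;q^{-1},3M)\,q^{M(3M+1)}=\sum_{a,b\ge 0}\frac{q^{a^2-3ab+3b^2+2b+1}}{(q^3;q^3)_b}\begin{bmatrix}3b-a+1\\ a\end{bmatrix}_q,$$ $$\lim_{M\to\infty}S(2,4;q^{-1},3M+2)\,q^{(M+2)(3M+1)}=\sum_{a,b\ge 0}\frac{q^{a^2-3ab+3b^2+2b-1}}{(q^3;q^3)_b}\begin{bmatrix}3b-a-1\\ a\end{bmatrix}_q.$$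
   Context: Here $q$ is a nonzero complex number with $|q|<1$, and $(x;q)_n=\prod_{i=0}^{n-1}(1-q^ix)$. For $k,l\in\mathbb{Z}$ the Gaussian binomial coefficient is $\begin{bmatrix}k\\ l\end{bmatrix}_q=\frac{(q;q)_k}{(q;q)_l(q;q)_{k-l}}$ if $k\ge l\ge 0$, and $0$ if $l<0$ or $k<l$ (in particular $\begin{bmatrix}-1\\ 0\end{bmatrix}_q=0$); the subscript $q^3$ means that $q$ is replaced by $q^3$. For an integer $N\ge 0$, $$S(2,4;q,N)=\sum_{m,n\ge 0}q^{m^2+3mn+3n^2+2m+4n}\begin{bmatrix}N-3n-m-1\\ m\end{bmatrix}_q\begin{bmatrix}\lfloor\frac23(N-1)\rfloor+\delta_{3\mid (N-2)}-m-n\\ n\end{bmatrix}_{q^3},$$ a polynomial in $q$, where $\delta_{3\mid (N-2)}$ is $1$ if $3$ divides $N-2$ and $0$ otherwise; $S(2,4;q^{-1},N)$ is the result of substituting $q^{-1}$ for $q$ in it. *)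

theory Defs
  imports "HOL-Analysis.Analysis"
begin

definition qpoch :: "complex \<Rightarrow> complex \<Rightarrow> nat \<Rightarrow> complex" where
  "qpoch x q n = (\<Prod>i<n. 1 - q ^ i * x)"

(* The quotient is taken at the given complex number q.  Whenever q is not a root of unity (for
   example 0 < |q| < 1 or |q| > 1) the denominator is nonzero, and the quotient is the value at q
   of the Gaussian polynomial.  Roots of unity are outside the scope of this definition. *)
definition gauss_binomial :: "complex \<Rightarrow> int \<Rightarrow> int \<Rightarrow> complex" where
  "gauss_binomial q k l =
     (if 0 \<le> l \<and> l \<le> k
      then qpoch q q (nat k) / (qpoch q q (nat l) * qpoch q q (nat (k - l)))
      else 0)"

definition S24_term :: "complex \<Rightarrow> nat \<Rightarrow> nat \<Rightarrow> nat \<Rightarrow> complex" where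
  "S24_term q N m n =
     q ^ (m\<^sup>2 + 3 * m * n + 3 * n\<^sup>2 + 2 * m + 4 * n)
     * gauss_binomial q (int N - 3 * int n - int m - 1) (int m)
     * gauss_binomial (q ^ 3)
         (\<lfloor>2 / 3 * (real N - 1)\<rfloor> + of_bool (3 dvd (int N - 2)) - int m - int n) (int n)"

(* Only finitely many terms are nonzero, see S24_finite_sum; as q is arbitrary here,
   the value of the polynomial at 1/q is S24 (inverse q) N. *)
definition S24 :: "complex \<Rightarrow> nat \<Rightarrow> complex" where
  "S24 q N = (\<Sum>\<^sub>\<infinity>(m, n)\<in>UNIV. S24_term q N m n)"

lemma S24_finite_sum: "S24 q N = (\<Sum>m\<le>N. \<Sum>n\<le>N. S24_term q N m n)"
proof -
  have vanish: "S24_term q N m n = 0" if "\<not> m \<le> N \<or> \<not> n \<le> N" for m n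
  proof -
    have "\<not> int m \<le> int N - 3 * int n - int m - 1"
      using that by linarith
    then show ?thesis
      by (simp only: S24_term_def gauss_binomial_def) simp
  qed
  have "S24 q N = (\<Sum>\<^sub>\<infinity>(m, n)\<in>{..N} \<times> {..N}. S24_term q N m n)"
    unfolding S24_def
    by (rule infsum_cong_neutral) (auto, (use vanish in blast)+)
  also have "\<dots> = (\<Sum>m\<le>N. \<Sum>n\<le>N. S24_term q N m n)"
    by (simp add: sum.cartesian_product)
  finally show ?thesis .
qed

(* The common summand of the three limits.  The exponent a^2 - 3ab + 3b^2 + 2b + c is an integer
   that may be -1 (for a = b = 0, c = -1), hence powi. *)
definition limit_term :: "complex \<Rightarrow> int \<Rightarrow> int \<Rightarrow> nat \<Rightarrow> nat \<Rightarrow> complex" where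
  "limit_term q c d a b =
     q powi ((int a)\<^sup>2 - 3 * int a * int b + 3 * (int b)\<^sup>2 + 2 * int b + c) / qpoch (q ^ 3) (q ^ 3) b
     * gauss_binomial q (3 * int b - int a + d) (int a)"

end

theory Submission
  imports Defs
begin

text \<open>
  The three limits are the cases $d = 0, 1, -1$ of one statement about $N = 3M + 1 - d$, for which
  the top entry of the second binomial coefficient is $2M - d - m - n$ and the normalizing power
  of $q$ is $P = (M + 1 - d)(3M + 1)$.

  Replacing $q$ by $q^{-1}$ in a Gaussian binomial coefficient only multiplies it by a power
  of $q$ (\<open>gauss_binomial_inverse\<close>).  In the resulting double sum one changes the
  summation variables from $(m, n)$ to
  $$a = 3M - d - 3n - 2m, \qquad b = 2M - d - m - 2n,$$
  which are the differences between the top and the bottom entry of the two binomial coefficients.  The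
  inverse substitution is $m = 3b - 2a + d$, $n = M - d - 2b + a$.  By the symmetry of the
  Gaussian binomial coefficients, the term of index $(m, n)$, multiplied by $q^P$, becomes
  $$q^{a^2 - 3ab + 3b^2 + 2b + 1 + d - d^2}
    \left[{3b - a + d \atop a}\right]_q \left[{M + a - b - d \atop b}\right]_{q^3},$$
  in which $M$ occurs only in the last factor (\<open>S24_term_inverse\<close>,
  \<open>S24_inverse_eq\<close>).  As $M \to \infty$ that factor tends to $1/(q^3;q^3)_b$
  (\<open>gauss_binomial_tendsto\<close>).

  The limit may be taken under the summation sign by dominated convergence
  (\<open>tendsto_infsum_dominated\<close>): the finite products $(q;q)_n$ are bounded and bounded
  away from $0$, because the infinite product converges to a nonzero value, so that all Gaussian
  binomial coefficients are uniformly bounded; and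
  $a^2 - 3ab + 3b^2 + 2b \ge a + b - 1$, so that the terms are dominated by a constant times
  $|q|^{a+b}$.
\<close>

section \<open>Dominated convergence for unordered sums\<close>

text \<open>A bound that is uniform in the parameter makes the partial sums converge uniformly in it
  (Weierstrass), so that the two limits can be exchanged.\<close>

lemma tendsto_infsum_dominated:
  fixes f :: "'i \<Rightarrow> 'a \<Rightarrow> 'b :: banach"
  assumes bound: "\<And>i x. x \<in> A \<Longrightarrow> norm (f i x) \<le> h x"
    and h: "h summable_on A"
    and lim: "\<And>x. x \<in> A \<Longrightarrow> ((\<lambda>i. f i x) \<longlongrightarrow> g x) F"
    and F: "F \<noteq> bot"
  shows "g summable_on A \<and> ((\<lambda>i. \<Sum>\<^sub>\<infinity>x\<in>A. f i x) \<longlongrightarrow> (\<Sum>\<^sub>\<infinity>x\<in>A. g x)) F"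
proof -
  have g_bound: "norm (g x) \<le> h x" if "x \<in> A" for x
    using Lim_norm_ubound[OF F lim[OF that]] bound[OF that] by simp
  have "(\<lambda>x. norm (g x)) summable_on A"
    by (rule summable_on_comparison_test[OF h]) (use g_bound in auto)
  then have g: "g summable_on A"
    by (rule abs_summable_summable)
  have "((\<lambda>i. \<Sum>\<^sub>\<infinity>x\<in>A. f i x) \<longlongrightarrow> (\<Sum>\<^sub>\<infinity>x\<in>A. g x)) F"
  proof (rule swap_uniform_limit')
    show "uniform_limit UNIV (\<lambda>X i. \<Sum>x\<in>X. f i x) (\<lambda>i. \<Sum>\<^sub>\<infinity>x\<in>A. f i x)
            (finite_subsets_at_top A)"
      by (rule Weierstrass_m_test_general[OF _ h]) (use bound in auto)
    show "\<forall>\<^sub>F X in finite_subsets_at_top A.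
            ((\<lambda>i. \<Sum>x\<in>X. f i x) \<longlongrightarrow> (\<Sum>x\<in>X. g x)) F"
      using eventually_finite_subsets_at_top_weakI
      by (rule eventually_mono) (auto intro!: tendsto_sum lim)
    show "((\<lambda>X. \<Sum>x\<in>X. g x) \<longlongrightarrow> (\<Sum>\<^sub>\<infinity>x\<in>A. g x)) (finite_subsets_at_top A)"
      using has_sum_infsum[OF g] by (simp add: has_sum_def)
  qed auto
  with g show ?thesis by blast
qed

section \<open>Gaussian binomial coefficients\<close>

lemma qpoch_nonzero:
  assumes "norm p < 1"
  shows "qpoch p p n \<noteq> 0"
proof -
  have "p ^ i * p \<noteq> 1" for i
  proof
    assume "p ^ i * p = 1"
    then have "norm p ^ Suc i = 1"
      by (metis norm_one norm_power power_Suc2)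
    moreover have "norm p ^ Suc i < 1"
      using assms power_less_one_iff[of "norm p" "Suc i"] by simp
    ultimately show False by simp
  qed
  then show ?thesis by (auto simp: qpoch_def)
qed

text \<open>The limit $(p;p)_\infty$ is nonzero; this is what bounds the denominators of the Gaussian
  binomial coefficients from below.\<close>

lemma qpoch_tendsto_nonzero:
  assumes "norm p < 1"
  obtains L where "L \<noteq> 0" "(\<lambda>n. qpoch p p n) \<longlonglongrightarrow> L"
proof -
  let ?f = "\<lambda>i. 1 - p ^ i * p"
  have "summable (\<lambda>i. norm p ^ i * norm p)"
    using assms by (intro summable_mult2 summable_geometric) auto
  then have "abs_convergent_prod ?f"
    by (intro summable_imp_abs_convergent_prod) (simp add: norm_mult norm_power)
  then have conv: "convergent_prod ?f"
    by (rule abs_convergent_prod_imp_convergent_prod)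
  have nz: "?f i \<noteq> 0" for i
    using qpoch_nonzero[OF assms, of "Suc i"] by (simp add: qpoch_def)
  have "(\<lambda>n. qpoch p p (Suc n)) \<longlonglongrightarrow> prodinf ?f"
    using convergent_prod_LIMSEQ[OF conv] by (simp add: qpoch_def lessThan_Suc_atMost)
  then have "(\<lambda>n. qpoch p p n) \<longlonglongrightarrow> prodinf ?f"
    by (rule LIMSEQ_imp_Suc)
  moreover have "prodinf ?f \<noteq> 0"
    using prodinf_nonzero[OF conv nz] .
  ultimately show ?thesis using that by blast
qed

lemma gauss_binomial_bounded:
  assumes "norm p < 1"
  obtains B where "B \<ge> 0" "\<And>k l. norm (gauss_binomial p k l) \<le> B"
proof -
  obtain L where L: "L \<noteq> 0" "(\<lambda>n. qpoch p p n) \<longlonglongrightarrow> L"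
    using qpoch_tendsto_nonzero[OF assms] .
  have "Bseq (\<lambda>n. qpoch p p n)"
    using L by (intro convergent_imp_Bseq convergentI)
  then obtain C where C: "C > 0" "\<And>n. norm (qpoch p p n) \<le> C"
    by (auto simp: Bseq_def)
  have "Bseq (\<lambda>n. inverse (qpoch p p n))"
    using L by (intro convergent_imp_Bseq convergentI[OF tendsto_inverse])
  then obtain D where D: "D > 0" "\<And>n. norm (inverse (qpoch p p n)) \<le> D"
    by (auto simp: Bseq_def)
  have "norm (gauss_binomial p k l) \<le> C * (D * D)" for k l
  proof (cases "0 \<le> l \<and> l \<le> k")
    case True
    then have "norm (gauss_binomial p k l)
        = norm (qpoch p p (nat k)) *
            (norm (inverse (qpoch p p (nat l))) * norm (inverse (qpoch p p (nat (k - l)))))"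
      by (simp add: gauss_binomial_def norm_mult norm_divide norm_inverse divide_simps)
    also have "\<dots> \<le> C * (D * D)"
      using C D by (intro mult_mono) auto
    finally show ?thesis .
  qed (use C D in \<open>auto simp: gauss_binomial_def\<close>)
  with C D show ?thesis using that[of "C * (D * D)"] by simp
qed

lemma gauss_binomial_tendsto:
  assumes "norm p < 1"
  shows "(\<lambda>n. gauss_binomial p (int n + e) (int b)) \<longlonglongrightarrow> 1 / qpoch p p b"
proof -
  obtain L where L: "L \<noteq> 0" "(\<lambda>n. qpoch p p n) \<longlonglongrightarrow> L"
    using qpoch_tendsto_nonzero[OF assms] .
  have nat_at_top: "filterlim (\<lambda>n. nat (int n + j)) sequentially sequentially" for j
    unfolding filterlim_at_top
  proof
    fix Z :: nat
    show "\<forall>\<^sub>F n in sequentially. Z \<le> nat (int n + j)"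
      using eventually_ge_at_top[of "nat (int Z - j)"] by eventually_elim linarith
  qed
  have "(\<lambda>n. qpoch p p (nat (int n + e)) /
           (qpoch p p b * qpoch p p (nat (int n + (e - int b))))) \<longlonglongrightarrow> L / (qpoch p p b * L)"
    using L qpoch_nonzero[OF assms]
    by (intro tendsto_intros filterlim_compose[OF L(2) nat_at_top]) auto
  moreover have "\<forall>\<^sub>F n in sequentially.
      qpoch p p (nat (int n + e)) / (qpoch p p b * qpoch p p (nat (int n + (e - int b))))
        = gauss_binomial p (int n + e) (int b)"
    using eventually_ge_at_top[of "nat (int b - e)"]
    by eventually_elim (auto simp: gauss_binomial_def add_diff_eq)
  ultimately show ?thesis
    using L by (auto dest: Lim_transform_eventually)
qed

lemma gauss_binomial_symmetric: "gauss_binomial q k (k - l) = gauss_binomial q k l"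
  by (auto simp: gauss_binomial_def mult.commute)

lemma qpoch_inverse:
  assumes "q \<noteq> 0"
  shows "qpoch (inverse q) (inverse q) n = (\<Prod>i<n. - (inverse q ^ Suc i)) * qpoch q q n"
  unfolding qpoch_def prod.distrib[symmetric] using assms
  by (intro prod.cong) (auto simp: field_simps)

text \<open>The product over $i < n$ equals $(-1)^n x^{n(n+1)/2}$.  Keeping it as a product avoids
  halving the exponent.\<close>

lemma prod_power_Suc_add:
  fixes x :: "'a :: comm_ring_1"
  shows "(\<Prod>i<m + n. - (x ^ Suc i)) = (\<Prod>i<m. - (x ^ Suc i)) * (\<Prod>i<n. - (x ^ Suc i)) * x ^ (m * n)"
  by (induction n) (auto simp: power_add algebra_simps)

lemma gauss_binomial_inverse:
  assumes "q \<noteq> 0"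
  shows "gauss_binomial (inverse q) k l = q powi (- (l * (k - l))) * gauss_binomial q k l"
proof (cases "0 \<le> l \<and> l \<le> k")
  case True
  define m n where "m = nat l" and "n = nat (k - l)"
  have k: "k = int (m + n)" and l: "l = int m"
    using True by (auto simp: m_def n_def)
  define w where "w = (\<lambda>n. \<Prod>i<n. - (inverse q ^ Suc i))"
  have w: "w (m + n) = w m * w n * inverse q ^ (m * n)"
    unfolding w_def by (rule prod_power_Suc_add)
  have w0: "w j \<noteq> 0" for j
    using assms by (auto simp: w_def)
  have "q powi (- (l * (k - l))) = inverse q ^ (m * n)"
    by (simp add: k l power_int_minus power_inverse flip: of_nat_mult)
  moreover have "gauss_binomial (inverse q) k l
      = (w (m + n) * qpoch q q (m + n)) / ((w m * qpoch q q m) * (w n * qpoch q q n))"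
    by (simp add: gauss_binomial_def k l qpoch_inverse[OF assms] w_def nat_int_add)
  moreover have "gauss_binomial q k l = qpoch q q (m + n) / (qpoch q q m * qpoch q q n)"
    by (simp add: gauss_binomial_def k l nat_int_add)
  ultimately show ?thesis
    using w0[of m] w0[of n] by (simp add: w)
qed (auto simp: gauss_binomial_def)

section \<open>Change of the summation variables\<close>

text \<open>The summand, before the limit is taken, of the normalized sum in the variables $(a, b)$.
  The last binomial coefficient has an integer top entry, so that the term vanishes when
  $n = M - d - 2b + a$ is negative, just as the middle one does when $m = 3b - 2a + d$ is negative.\<close>

definition level_term :: "complex \<Rightarrow> int \<Rightarrow> nat \<Rightarrow> nat \<Rightarrow> nat \<Rightarrow> complex" where
  "level_term q d M a b =
     q powi ((int a)\<^sup>2 - 3 * int a * int b + 3 * (int b)\<^sup>2 + 2 * int b + (1 + d - d\<^sup>2))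
     * gauss_binomial q (3 * int b - int a + d) (int a)
     * gauss_binomial (q ^ 3) (int M + (int a - int b - d)) (int b)"

lemma S24_term_inverse:
  assumes q: "q \<noteq> 0"
    and N: "int N = 3 * int M + 1 - d"
    and K: "\<lfloor>2 / 3 * (real N - 1)\<rfloor> + of_bool (3 dvd (int N - 2)) = 2 * int M - d"
    and P: "int P = (int M + 1 - d) * (3 * int M + 1)"
    and m: "int m = 3 * int b - 2 * int a + d"
    and n: "int n = int M - d - 2 * int b + int a"
  shows "S24_term (inverse q) N m n * q ^ P = level_term q d M a b"
proof -
  let ?G = "gauss_binomial q (3 * int b - int a + d) (int a)"
  let ?H = "gauss_binomial (q ^ 3) (int M + (int a - int b - d)) (int b)"
  let ?e = "m\<^sup>2 + 3 * m * n + 3 * n\<^sup>2 + 2 * m + 4 * n"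
  have "int N - 3 * int n - int m - 1 = 3 * int b - int a + d"
    using N m n by simp
  moreover have "gauss_binomial q (3 * int b - int a + d) (int m) = ?G"
    by (subst gauss_binomial_symmetric[symmetric]) (simp add: m)
  moreover have "3 * int b - int a + d - int m = int a"
    using m by simp
  ultimately have G: "gauss_binomial (inverse q) (int N - 3 * int n - int m - 1) (int m)
      = q powi (- (int m * int a)) * ?G"
    by (simp only: gauss_binomial_inverse[OF q])
  have "2 * int M - d - int m - int n = int M + (int a - int b - d)"
    using m n by simp
  moreover have "gauss_binomial (q ^ 3) (int M + (int a - int b - d)) (int n) = ?H"
    by (subst gauss_binomial_symmetric[symmetric]) (simp add: n)
  moreover have "int M + (int a - int b - d) - int n = int b"
    using n by simp
  ultimately have "gauss_binomial (inverse q ^ 3) (2 * int M - d - int m - int n) (int n)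
      = (q ^ 3) powi (- (int n * int b)) * ?H"
    by (simp only: power_inverse gauss_binomial_inverse[OF power_not_zero[OF q]])
  also have "(q ^ 3) powi (- (int n * int b)) = q powi (3 * (- (int n * int b)))"
    by (subst power_int_mult) simp
  finally have H: "gauss_binomial (inverse q ^ 3) (2 * int M - d - int m - int n) (int n)
      = q powi (3 * (- (int n * int b))) * ?H" .
  have "S24_term (inverse q) N m n * q ^ P
      = (q powi (- int ?e) * q powi (- (int m * int a)) * q powi (3 * (- (int n * int b)))
          * q powi (int P)) * ?G * ?H"
    unfolding S24_term_def K G H unfolding power_int_minus[of q "int ?e"] power_int_of_nat power_inverse
    by (simp only: mult_ac)
  also have "q powi (- int ?e) * q powi (- (int m * int a)) * q powi (3 * (- (int n * int b)))
          * q powi (int P) = q powi (- int ?e - int m * int a - 3 * (int n * int b) + int P)"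
    by (simp only: diff_conv_add_uminus power_int_add[OF disjI1[OF q]] mult_minus_right)
  also have "- int ?e - int m * int a - 3 * (int n * int b) + int P
      = (int a)\<^sup>2 - 3 * int a * int b + 3 * (int b)\<^sup>2 + 2 * int b + (1 + d - d\<^sup>2)"
    unfolding P by (simp add: m n) (simp add: algebra_simps power2_eq_square)
  finally show ?thesis
    unfolding level_term_def .
qed

text \<open>The terms with nonzero binomial coefficients on the two sides correspond under a bijection:
  the conditions that the binomial coefficients impose on $(m, n)$ say that $a, b \ge 0$, and those
  that they impose on $(a, b)$ say that $m, n \ge 0$.\<close>

lemma S24_inverse_eq:
  assumes q: "q \<noteq> 0"
    and N: "int N = 3 * int M + 1 - d"
    and K: "\<lfloor>2 / 3 * (real N - 1)\<rfloor> + of_bool (3 dvd (int N - 2)) = 2 * int M - d"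
    and P: "int P = (int M + 1 - d) * (3 * int M + 1)"
  shows "S24 (inverse q) N * q ^ P = (\<Sum>\<^sub>\<infinity>(a, b)\<in>UNIV. level_term q d M a b)"
proof -
  define S :: "(nat \<times> nat) set" where
    "S = {(m, n). 3 * int n + 2 * int m \<le> 3 * int M - d \<and> int m + 2 * int n \<le> 2 * int M - d}"
  define T :: "(nat \<times> nat) set" where
    "T = {(a, b). 2 * int a \<le> 3 * int b + d \<and> 2 * int b \<le> int M - d + int a}"
  define i where "i = (\<lambda>(a, b).
    (nat (3 * int b - 2 * int a + d), nat (int M - d - 2 * int b + int a)))"
  define j where "j = (\<lambda>(m, n).
    (nat (3 * int M - d - 3 * int n - 2 * int m), nat (2 * int M - d - int m - 2 * int n)))"
  have vanish: "S24_term (inverse q) N m n = 0" if "(m, n) \<notin> S" for m n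
  proof -
    have "\<not> int m \<le> int N - 3 * int n - int m - 1 \<or> \<not> int n \<le> 2 * int M - d - int m - int n"
      using that by (auto simp: S_def N)
    then show ?thesis
      by (simp only: S24_term_def gauss_binomial_def K) auto
  qed
  have vanish': "level_term q d M a b = 0" if "(a, b) \<notin> T" for a b
  proof -
    have "\<not> int a \<le> 3 * int b - int a + d \<or> \<not> int b \<le> int M + (int a - int b - d)"
      using that by (auto simp: T_def)
    then show ?thesis
      by (simp only: level_term_def gauss_binomial_def) auto
  qed
  have "S24 (inverse q) N * q ^ P = (\<Sum>\<^sub>\<infinity>(m, n)\<in>UNIV. S24_term (inverse q) N m n * q ^ P)"
    unfolding S24_def by (simp add: infsum_cmult_left' case_prod_unfold)
  also have "\<dots> = (\<Sum>\<^sub>\<infinity>(m, n)\<in>S. S24_term (inverse q) N m n * q ^ P)"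
    by (rule infsum_cong_neutral) (use vanish in auto)
  also have "\<dots> = (\<Sum>\<^sub>\<infinity>(a, b)\<in>T. level_term q d M a b)"
  proof (rule infsum_reindex_bij_witness[of _ i j])
    fix x assume "x \<in> S"
    then show "(case j x of (a, b) \<Rightarrow> level_term q d M a b)
        = (case x of (m, n) \<Rightarrow> S24_term (inverse q) N m n * q ^ P)"
      by (auto simp: S_def j_def intro!: S24_term_inverse[OF q N K P, symmetric])
  qed (auto simp: S_def T_def i_def j_def)
  also have "\<dots> = (\<Sum>\<^sub>\<infinity>(a, b)\<in>UNIV. level_term q d M a b)"
    by (rule infsum_cong_neutral) (use vanish' in auto)
  finally show ?thesis .
qed

section \<open>Passage to the limit\<close>

lemma quadratic_exponent_bound:
  fixes a b :: int
  shows "a + b - 1 \<le> a\<^sup>2 - 3 * a * b + 3 * b\<^sup>2 + 2 * b"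
proof -
  \<comment> \<open>Four times the difference of the two sides is a sum of squares plus a constant.\<close>
  have "0 \<le> (2 * a - 3 * b - 1)\<^sup>2 + (b - 1)\<^sup>2 + 2 * b\<^sup>2 + 2"
    by simp
  also have "\<dots> = 4 * (a\<^sup>2 - 3 * a * b + 3 * b\<^sup>2 + 2 * b - (a + b - 1))"
    by algebra
  finally have "0 \<le> 4 * (a\<^sup>2 - 3 * a * b + 3 * b\<^sup>2 + 2 * b - (a + b - 1))" .
  then show ?thesis by (simp only: zero_le_mult_iff) simp
qed

lemma geometric_summable_on_pairs:
  fixes r :: real
  assumes "0 \<le> r" "r < 1"
  shows "(\<lambda>(a, b). r ^ (a + b)) summable_on (UNIV :: (nat \<times> nat) set)"
proof -
  have geo: "((\<lambda>b. r ^ b) has_sum (1 / (1 - r))) UNIV"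
    using assms geometric_sums[of r] by (intro norm_summable_imp_has_sum) (auto simp: norm_power)
  have "(\<lambda>(a, b). r ^ (a + b)) summable_on (SIGMA a:UNIV. (UNIV :: nat set))"
  proof (rule summable_on_SigmaI)
    fix a :: nat
    show "((\<lambda>b. case (a, b) of (a, b) \<Rightarrow> r ^ (a + b)) has_sum (r ^ a * (1 / (1 - r)))) UNIV"
      using has_sum_cmult_right[OF geo, of "r ^ a"] by (simp add: power_add)
  next
    show "(\<lambda>a. r ^ a * (1 / (1 - r))) summable_on UNIV"
      using geo by (intro summable_on_cmult_left) (auto simp: summable_on_def)
  qed (use assms in auto)
  then show ?thesis by simp
qed

lemma S24_inverse_tendsto:
  assumes q: "q \<noteq> 0" "norm q < 1"
    and N: "\<And>M. int (N M) = 3 * int M + 1 - d"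
    and K: "\<And>M. \<lfloor>2 / 3 * (real (N M) - 1)\<rfloor> + of_bool (3 dvd (int (N M) - 2)) = 2 * int M - d"
    and P: "\<And>M. int (P M) = (int M + 1 - d) * (3 * int M + 1)"
    and c: "c = 1 + d - d\<^sup>2"
  shows "(\<lambda>(a, b). limit_term q c d a b) summable_on UNIV \<and>
    (\<lambda>M. S24 (inverse q) (N M) * q ^ P M) \<longlonglongrightarrow> (\<Sum>\<^sub>\<infinity>(a, b)\<in>UNIV. limit_term q c d a b)"
proof -
  define r where "r = norm q"
  have r: "0 < r" "r < 1"
    using q by (auto simp: r_def)
  have q3: "norm (q ^ 3) < 1"
    using q by (simp add: norm_power power_less_one_iff)
  obtain B where B: "B \<ge> 0" "\<And>k l. norm (gauss_binomial q k l) \<le> B"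
    using gauss_binomial_bounded[OF q(2)] by metis
  obtain C where C: "C \<ge> 0" "\<And>k l. norm (gauss_binomial (q ^ 3) k l) \<le> C"
    using gauss_binomial_bounded[OF q3] by metis
  define D where "D = r powi (c - 1) * B * C"
  have bound: "norm (level_term q d M a b) \<le> D * r ^ (a + b)" for M a b
  proof -
    let ?e = "(int a)\<^sup>2 - 3 * int a * int b + 3 * (int b)\<^sup>2 + 2 * int b + c"
    have "r powi ?e \<le> r powi (int (a + b) + (c - 1))"
      using quadratic_exponent_bound[of "int a" "int b"] r
      by (intro power_int_decreasing) auto
    also have "\<dots> = r ^ (a + b) * r powi (c - 1)"
      using r power_int_add[of r "int (a + b)" "c - 1"] by (simp only: power_int_of_nat) auto
    finally have e: "r powi ?e \<le> r ^ (a + b) * r powi (c - 1)" .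
    have "norm (level_term q d M a b) \<le> (r ^ (a + b) * r powi (c - 1)) * B * C"
      unfolding level_term_def c[symmetric] norm_mult norm_power_int r_def[symmetric]
      using e B C r by (intro mult_mono) auto
    then show ?thesis
      by (simp add: D_def mult_ac)
  qed
  have lim: "(\<lambda>M. level_term q d M a b) \<longlonglongrightarrow> limit_term q c d a b" for a b
  proof -
    have "(\<lambda>M. level_term q d M a b) \<longlonglongrightarrow>
        q powi ((int a)\<^sup>2 - 3 * int a * int b + 3 * (int b)\<^sup>2 + 2 * int b + (1 + d - d\<^sup>2))
        * gauss_binomial q (3 * int b - int a + d) (int a) * (1 / qpoch (q ^ 3) (q ^ 3) b)"
      unfolding level_term_def by (intro tendsto_intros gauss_binomial_tendsto q3)
    then show ?thesis
      by (simp add: limit_term_def c)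
  qed
  have "(\<lambda>(a, b). D * r ^ (a + b)) summable_on (UNIV :: (nat \<times> nat) set)"
    using summable_on_cmult_right[OF geometric_summable_on_pairs[of r], of D] r
    by (simp add: case_prod_unfold)
  then have "(\<lambda>(a, b). limit_term q c d a b) summable_on UNIV \<and>
      (\<lambda>M. \<Sum>\<^sub>\<infinity>(a, b)\<in>UNIV. level_term q d M a b) \<longlonglongrightarrow> (\<Sum>\<^sub>\<infinity>(a, b)\<in>UNIV. limit_term q c d a b)"
    by (intro tendsto_infsum_dominated) (use bound lim in auto)
  moreover have "S24 (inverse q) (N M) * q ^ P M = (\<Sum>\<^sub>\<infinity>(a, b)\<in>UNIV. level_term q d M a b)" for M
    by (rule S24_inverse_eq[OF q(1) N K P])
  ultimately show ?thesis by simp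
qed

theorem theorem5p2:
  fixes q :: complex
  assumes "q \<noteq> 0" and "norm q < 1"
  shows
    "((\<lambda>(a, b). limit_term q 1 0 a b) summable_on UNIV \<and>
      (\<lambda>M. S24 (inverse q) (3 * M + 1) * q ^ ((M + 1) * (3 * M + 1)))
        \<longlonglongrightarrow> (\<Sum>\<^sub>\<infinity>(a, b)\<in>UNIV. limit_term q 1 0 a b)) \<and>
     ((\<lambda>(a, b). limit_term q 1 1 a b) summable_on UNIV \<and>
      (\<lambda>M. S24 (inverse q) (3 * M) * q ^ (M * (3 * M + 1)))
        \<longlonglongrightarrow> (\<Sum>\<^sub>\<infinity>(a, b)\<in>UNIV. limit_term q 1 1 a b)) \<and>
     ((\<lambda>(a, b). limit_term q (- 1) (- 1) a b) summable_on UNIV \<and>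
      (\<lambda>M. S24 (inverse q) (3 * M + 2) * q ^ ((M + 2) * (3 * M + 1)))
        \<longlonglongrightarrow> (\<Sum>\<^sub>\<infinity>(a, b)\<in>UNIV. limit_term q (- 1) (- 1) a b))"
proof (intro conjI[of "_ \<and> _"])
  have "\<lfloor>2 / 3 * (real (3 * M + 1) - 1)\<rfloor> + of_bool (3 dvd (int (3 * M + 1) - 2)) = 2 * int M - 0" for M
  proof -
    have "\<lfloor>2 / 3 * (real (3 * M + 1) - 1)\<rfloor> = 2 * int M"
      by (rule floor_unique) auto
    moreover have "\<not> 3 dvd (int (3 * M + 1) - 2)"
      by presburger
    ultimately show ?thesis by simp
  qed
  then show "(\<lambda>(a, b). limit_term q 1 0 a b) summable_on UNIV \<and>
      (\<lambda>M. S24 (inverse q) (3 * M + 1) * q ^ ((M + 1) * (3 * M + 1)))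
        \<longlonglongrightarrow> (\<Sum>\<^sub>\<infinity>(a, b)\<in>UNIV. limit_term q 1 0 a b)"
    by (intro S24_inverse_tendsto assms) (auto simp: algebra_simps)
next
  have "\<lfloor>2 / 3 * (real (3 * M) - 1)\<rfloor> + of_bool (3 dvd (int (3 * M) - 2)) = 2 * int M - 1" for M
  proof -
    have "\<lfloor>2 / 3 * (real (3 * M) - 1)\<rfloor> = 2 * int M - 1"
      by (rule floor_unique) (auto simp: field_simps)
    moreover have "\<not> 3 dvd (int (3 * M) - 2)"
      by presburger
    ultimately show ?thesis by simp
  qed
  then show "(\<lambda>(a, b). limit_term q 1 1 a b) summable_on UNIV \<and>
      (\<lambda>M. S24 (inverse q) (3 * M) * q ^ (M * (3 * M + 1)))
        \<longlonglongrightarrow> (\<Sum>\<^sub>\<infinity>(a, b)\<in>UNIV. limit_term q 1 1 a b)"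
    by (intro S24_inverse_tendsto assms) (auto simp: algebra_simps)
next
  have "\<lfloor>2 / 3 * (real (3 * M + 2) - 1)\<rfloor> + of_bool (3 dvd (int (3 * M + 2) - 2))
      = 2 * int M - (- 1)" for M
  proof -
    have "\<lfloor>2 / 3 * (real (3 * M + 2) - 1)\<rfloor> = 2 * int M"
      by (rule floor_unique) (auto simp: field_simps)
    moreover have "3 dvd (int (3 * M + 2) - 2)"
      by presburger
    ultimately show ?thesis by simp
  qed
  then show "(\<lambda>(a, b). limit_term q (- 1) (- 1) a b) summable_on UNIV \<and>
      (\<lambda>M. S24 (inverse q) (3 * M + 2) * q ^ ((M + 2) * (3 * M + 1)))
        \<longlonglongrightarrow> (\<Sum>\<^sub>\<infinity>(a, b)\<in>UNIV. limit_term q (- 1) (- 1) a b)"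
    by (intro S24_inverse_tendsto assms) (auto simp: algebra_simps)
qed

end
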